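(* Let $p_{3,3}(n)$ be defined by $\sum_{n\ge0}p_{3,3}(n)q^n=\frac{1}{E_1^3E_3^3}$. Let $m(i,j)$ and $b(j,k)$ be the integer matrices defined below. Then for every positive integer $j$, $$\sum_{n=0}^{\infty}p_{3,3}\left(3^{j}n+\tfrac{3^{j}+1}{2}\right)q^{n}=\sum_{l=1}^{\infty}b(j,l)q^{l-1}\frac{E_{3}^{12l-3}}{E_{1}^{12l+3}}.$$
   Context: $E_j=(q^j;q^j)_\infty=\prod_{n\ge1}(1-q^{jn})$. The matrix $\{m(i,j)\}_{i,j\ge1}$ is defined by (with $m(i,j)=0$ for $i\le0$): $m(1,1)=9$, $m(2,1)=6$, $m(3,1)=1$, $m(i,1)=0$ for $i\ge4$, and for $j\ge2$, $m(i,j)=27m(i-1,j-1)+9m(i-2,j-1)+m(i-3,j-1)$. The matrix $\{b(j,k)\}_{j,k\ge1}$ is defined by $b(1,1)=9$, $b(1,k)=0$ for $k\ge2$, and $b(j+1,k)=\sum_{i\ge1}b(j,i)m(4i+1,i+k)$ for $j,k\ge1$ (a finite sum). *)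

theory Defs
  imports "HOL-Analysis.Analysis"
begin

text \<open>
  Identities between \<open>q\<close>-series are identities of formal power series over the rationals, with
  \<open>q\<close> being \<^const>\<open>fps_X\<close>. Infinite sums and products refer to the metric on \<^typ>\<open>rat fps\<close>,
  in which convergence means that every coefficient is eventually constant.
\<close>

definition euler_E :: "nat \<Rightarrow> rat fps" where
  "euler_E j = (\<Prod>n. 1 - fps_X ^ (j * Suc n))"

text \<open>
  \<^const>\<open>prodinf\<close> is a definite description, so we record that the product really converges
  for positive \<open>j\<close>.
\<close>

lemma euler_E_has_prod:
  assumes "j > 0"
  shows   "(\<lambda>n. 1 - fps_X ^ (j * Suc n)) has_prod euler_E j"
proof -
  define f :: "nat \<Rightarrow> rat fps" where "f = (\<lambda>n. 1 - fps_X ^ (j * Suc n))"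
  define P where "P = Abs_fps (\<lambda>n. fps_nth (\<Prod>k\<le>n. f k) n)"
  have stable: "fps_nth (\<Prod>k\<le>m. f k) n = fps_nth (\<Prod>k\<le>n. f k) n" if "m \<ge> n" for m n
    using that
  proof (induction m rule: dec_induct)
    case (step m)
    have "n < j * Suc (Suc m)"
      using assms step.hyps by (cases j) auto
    hence "fps_nth ((\<Prod>k\<le>m. f k) * fps_X ^ (j * Suc (Suc m))) n = 0"
      by (simp only: fps_X_power_mult_right_nth if_True)
    moreover have "(\<Prod>k\<le>Suc m. f k) = (\<Prod>k\<le>m. f k) - (\<Prod>k\<le>m. f k) * fps_X ^ (j * Suc (Suc m))"
      by (simp add: f_def algebra_simps del: mult_Suc_right)
    ultimately show ?case
      using step.IH by (simp del: prod.atMost_Suc)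
  qed simp
  have lim: "(\<lambda>n. \<Prod>k\<le>n. f k) \<longlonglongrightarrow> P"
    by (rule tendsto_fpsI, rule eventually_sequentiallyI) (auto simp: P_def intro: stable)
  have "fps_nth P 0 = 1"
    using assms by (simp add: P_def f_def)
  hence "P \<noteq> 0"
    by auto
  with lim have "f has_prod P"
    by (auto simp: has_prod_def raw_has_prod_def)
  moreover from this have "P = euler_E j"
    unfolding euler_E_def f_def by (rule has_prod_unique)
  ultimately show ?thesis
    by (simp add: f_def)
qed

definition p33 :: "nat \<Rightarrow> rat" where
  "p33 n = fps_nth (1 / (euler_E 1 ^ 3 * euler_E 3 ^ 3)) n"

text \<open>
  In both matrices the column index, and in \<open>b_mat\<close> also the row index, starts at 1; the values at
  index 0 are junk. Row indices of \<open>m_mat\<close> are integers, to allow for \<open>m_mat i j = 0\<close> when \<open>i \<le> 0\<close>.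
\<close>

fun m_mat :: "int \<Rightarrow> nat \<Rightarrow> int" where
  "m_mat i 0 = 0"
| "m_mat i (Suc 0) = (if i = 1 then 9 else if i = 2 then 6 else if i = 3 then 1 else 0)"
| "m_mat i (Suc (Suc j)) =
     (if i \<le> 0 then 0
      else 27 * m_mat (i - 1) (Suc j) + 9 * m_mat (i - 2) (Suc j) + m_mat (i - 3) (Suc j))"

text \<open>
  The sum over all \<open>i \<ge> 1\<close> is taken over the indices with nonzero summand, since \<^const>\<open>sum\<close>
  is 0 on an infinite set; this index set is finite by \<open>b_mat_support_finite\<close> below.
\<close>

fun b_mat :: "nat \<Rightarrow> nat \<Rightarrow> int" where
  "b_mat 0 k = 0"
| "b_mat (Suc 0) k = (if k = 1 then 9 else 0)"
| "b_mat (Suc (Suc j)) k =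
     (\<Sum>i | 1 \<le> i \<and> b_mat (Suc j) i * m_mat (4 * int i + 1) (i + k) \<noteq> 0.
        b_mat (Suc j) i * m_mat (4 * int i + 1) (i + k))"

lemma m_mat_eq_0: "i > 3 * int j \<Longrightarrow> m_mat i j = 0"
  by (induction i j rule: m_mat.induct) auto

lemma b_mat_support_finite:
  "finite {i. 1 \<le> i \<and> b_mat (Suc j) i * m_mat (4 * int i + 1) (i + k) \<noteq> 0}"
proof (rule finite_subset)
  show "{i. 1 \<le> i \<and> b_mat (Suc j) i * m_mat (4 * int i + 1) (i + k) \<noteq> 0} \<subseteq> {..3 * k}"
  proof
    fix i assume "i \<in> {i. 1 \<le> i \<and> b_mat (Suc j) i * m_mat (4 * int i + 1) (i + k) \<noteq> 0}"
    hence "m_mat (4 * int i + 1) (i + k) \<noteq> 0"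
      by simp
    hence "\<not> 4 * int i + 1 > 3 * int (i + k)"
      using m_mat_eq_0 by blast
    thus "i \<in> {..3 * k}"
      by simp
  qed
qed simp

end

theory Submission
  imports Defs "HOL-Computational_Algebra.Formal_Laurent_Series"
begin

text \<open>
  By Jacobi's identity, \<open>E\<^sub>1\<^sup>3\<close> is the sum of \<open>(-1)\<^sup>n (2n+1) q\<close> to the power \<open>n(n+1)/2\<close>. Sorting the
  exponents modulo 3 gives \<open>E\<^sub>1\<^sup>3 = p - 3g\<close> with \<open>g = q E\<^sub>9\<^sup>3\<close> and a series \<open>p\<close> in \<open>q\<^sup>3\<close>. The product of
  \<open>E\<^sub>1(\<omega>\<^sup>k q)\<close> over the third roots of unity \<open>\<omega>\<^sup>k\<close> is \<open>E\<^sub>3\<^sup>4 / E\<^sub>9\<close>, so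
  \<open>p\<^sup>3 - 27 g\<^sup>3 = E\<^sub>3\<^bsup>12\<^esup> / E\<^sub>9\<^sup>3\<close>. Hence \<open>y = g / E\<^sub>1\<^sup>3\<close> satisfies
  \<open>y\<^sup>3 = T(q\<^sup>3) (1 + 9y + 27y\<^sup>2)\<close> where \<open>T = q E\<^sub>3\<^bsup>12\<^esup> / E\<^sub>1\<^bsup>12\<^esup>\<close>. Let \<open>U\<close> keep the exponents
  divisible by 3 and replace \<open>q\<^sup>3\<close> by \<open>q\<close>. This cubic equation turns into the recurrence of
  \<open>m(i,j)\<close>, so that \<open>U(y\<^sup>i)\<close> is the sum of the \<open>m(i,j) T\<^sup>j\<close>. Up to a series in \<open>q\<^sup>3\<close>, the
  \<open>l\<close>-th term of the expansion is \<open>y\<^bsup>4l+1\<^esup>\<close>, and an induction on the exponent of 3 finishes the proof.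
\<close>

section \<open>Congruences of power series modulo powers of q\<close>

lemma fps_X_power_dvd_iff_nth: "fps_X ^ k dvd (f :: rat fps) \<longleftrightarrow> (\<forall>i<k. fps_nth f i = 0)"
proof
  assume "fps_X ^ k dvd f"
  then show "\<forall>i<k. fps_nth f i = 0"
    by (auto elim!: dvdE simp: fps_X_power_mult_nth)
next
  assume *: "\<forall>i<k. fps_nth f i = 0"
  have "f = fps_X ^ k * fps_shift k f"
    using * by (intro fps_ext) (auto simp: fps_X_power_mult_nth)
  then show "fps_X ^ k dvd f"
    by (metis dvd_triv_left)
qed

text \<open>Limits are handled through this criterion: infinite products and sums are replaced by
  finite truncations modulo each power of q, and equality is recovered at the end.\<close>

lemma eq_if_fps_X_power_dvd_diff:
  fixes f g :: "rat fps"
  assumes "\<And>k. fps_X ^ k dvd f - g"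
  shows   "f = g"
proof (rule fps_ext)
  fix n
  show "fps_nth f n = fps_nth g n"
    using assms[of "Suc n"] unfolding fps_X_power_dvd_iff_nth by simp
qed

lemma dvd_diff_mult:
  fixes a b c d x :: "'a::comm_ring_1"
  assumes "x dvd a - b" "x dvd c - d"
  shows   "x dvd a * c - b * d"
proof -
  have "a * c - b * d = (a - b) * c + b * (c - d)"
    by (simp add: algebra_simps)
  with assms show ?thesis by simp
qed

lemma dvd_diff_power:
  fixes a b x :: "'a::comm_ring_1"
  shows "x dvd a - b \<Longrightarrow> x dvd a ^ n - b ^ n"
  by (induction n) (auto intro: dvd_diff_mult)

lemma dvd_diff_sum:
  fixes f g :: "'i \<Rightarrow> 'a::comm_ring_1"
  assumes "\<And>i. i \<in> A \<Longrightarrow> x dvd f i - g i"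
  shows   "x dvd sum f A - sum g A"
  unfolding sum_subtractf[symmetric] by (rule dvd_sum) (use assms in auto)

lemma dvd_diff_trans:
  fixes a b c x :: "'a::comm_ring_1"
  shows "x dvd a - b \<Longrightarrow> x dvd b - c \<Longrightarrow> x dvd a - c"
  by (drule (1) dvd_add) simp

lemma dvd_diff_sym:
  fixes a b x :: "'a::comm_ring_1"
  shows "x dvd a - b \<Longrightarrow> x dvd b - a"
  by (metis dvd_minus_iff minus_diff_eq)

section \<open>Finite products, Gaussian binomials and the q-binomial theorem\<close>

text \<open>The finite product (q^j; q^j)_n, a truncation of \<open>euler_E j\<close>.\<close>

definition qpoch :: "nat \<Rightarrow> nat \<Rightarrow> rat fps" where
  "qpoch j n = (\<Prod>k=1..n. 1 - fps_X ^ (j * k))"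

lemma qpoch_0 [simp]: "qpoch j 0 = 1"
  by (simp add: qpoch_def)

lemma qpoch_Suc [simp]: "qpoch j (Suc n) = qpoch j n * (1 - fps_X ^ (j * Suc n))"
  by (simp add: qpoch_def)

text \<open>Every factor with index m + 1 > n is 1 modulo q^(n+1), because j (m + 1) >= n +
  1.\<close>

lemma qpoch_diff_dvd:
  assumes "j > 0" "m \<ge> n"
  shows   "fps_X ^ Suc n dvd qpoch j m - qpoch j n"
  using assms(2)
proof (induction m rule: dec_induct)
  case (step m)
  have "Suc n \<le> j * Suc m"
    using assms(1) step.hyps by (cases j) auto
  then have "fps_X ^ Suc n dvd (fps_X ^ (j * Suc m) :: rat fps)"
    by (rule le_imp_power_dvd)
  then have "fps_X ^ Suc n dvd (qpoch j m - qpoch j n) - qpoch j m * fps_X ^ (j * Suc m)"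
    by (intro dvd_diff dvd_mult step.IH)
  then show ?case
    by (simp only: qpoch_Suc) (simp add: algebra_simps del: mult_Suc_right)
qed simp

lemma euler_E_diff_qpoch_dvd:
  assumes "j > 0"
  shows   "fps_X ^ Suc n dvd euler_E j - qpoch j n"
proof -
  have eq: "(\<Prod>k\<le>m. 1 - fps_X ^ (j * Suc k)) = qpoch j (Suc m)" for m
    by (induction m) (simp_all del: mult_Suc_right)
  have "(\<lambda>m. qpoch j (Suc m)) \<longlonglongrightarrow> euler_E j"
    using has_prod_imp_tendsto[OF euler_E_has_prod[OF assms]] by (simp only: eq)
  then have lim: "\<forall>\<^sub>F m in sequentially. fps_nth (qpoch j (Suc m)) i = fps_nth (euler_E j) i" for i
    by (auto simp: tendsto_fps_iff)
  show ?thesis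
    unfolding fps_X_power_dvd_iff_nth
  proof (intro allI impI)
    fix i assume i: "i < Suc n"
    \<comment> \<open>Coefficients of the partial products are eventually constant, so some late
      partial product already has the limiting i-th coefficient.\<close>
    obtain m where m: "m \<ge> n" "fps_nth (qpoch j (Suc m)) i = fps_nth (euler_E j) i"
      using eventually_happens[OF eventually_conj[OF lim eventually_ge_at_top[of n]]]
      by auto
    have "fps_X ^ Suc n dvd qpoch j (Suc m) - qpoch j n"
      using assms m(1) by (intro qpoch_diff_dvd) auto
    then show "fps_nth (euler_E j - qpoch j n) i = 0"
      using i m(2) unfolding fps_X_power_dvd_iff_nth by auto
  qed
qed

lemma euler_E_nth_0 [simp]: "j > 0 \<Longrightarrow> fps_nth (euler_E j) 0 = 1"
  using euler_E_diff_qpoch_dvd[of j 0] unfolding fps_X_power_dvd_iff_nth by simp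

lemma euler_E_nonzero [simp]: "j > 0 \<Longrightarrow> euler_E j \<noteq> 0"
  using euler_E_nth_0[of j] by (metis fps_zero_nth zero_neq_one)

text \<open>The subtraction \<open>n - k\<close> below truncates only when \<open>k > n\<close>, where it is multiplied by 0.\<close>

fun qbinom :: "'a::comm_ring_1 \<Rightarrow> nat \<Rightarrow> nat \<Rightarrow> 'a" where
  "qbinom q n 0 = 1"
| "qbinom q 0 (Suc k) = 0"
| "qbinom q (Suc n) (Suc k) = qbinom q n (Suc k) + q ^ (n - k) * qbinom q n k"

lemma qbinom_eq_0: "k > n \<Longrightarrow> qbinom q n k = 0"
  by (induction q n k rule: qbinom.induct) auto

text \<open>The quotient formula for Gaussian binomials with denominators cleared. The q-Pascal rule
  works because (1 - q^(n-k)) + (q^(n-k) - q^(n+1)) = 1 - q^(n+1).\<close>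

lemma qbinom_qpoch:
  assumes "k \<le> n"
  shows "qbinom fps_X n k * (qpoch 1 k * qpoch 1 (n - k)) = qpoch 1 n"
  using assms
proof (induction "fps_X :: rat fps" n k rule: qbinom.induct)
  case (3 n k)
  have 2: "qbinom fps_X n k * (qpoch 1 k * qpoch 1 (n - k)) = qpoch 1 n"
    using 3 by simp
  have p: "fps_X ^ (n - k) * fps_X ^ Suc k = (fps_X ^ Suc n :: rat fps)"
    using 3(3) by (simp flip: power_add)
  show ?case
  proof (cases "k = n")
    case True
    then show ?thesis
      using 2 by (simp add: qbinom_eq_0)
  next
    case False
    then obtain d where d: "n - k = Suc d" "n - Suc k = d"
      using 3(3) by (metis Suc_diff_Suc Suc_le_mono le_neq_implies_less)
    have 1: "qbinom fps_X n (Suc k) * (qpoch 1 (Suc k) * qpoch 1 d) = qpoch 1 n"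
      using 3 False d by simp
    have *: "qpoch 1 (n - k) = qpoch 1 d - qpoch 1 d * fps_X ^ (n - k)"
      "qpoch 1 (Suc k) = qpoch 1 k - qpoch 1 k * fps_X ^ Suc k"
      unfolding d(1) by (simp_all add: algebra_simps)
    \<comment> \<open>Here w = q^(n-k) and v = q^(k+1), so that w v = q^(n+1). The identity regroups
      the product so that both induction hypotheses apply.\<close>
    have "(B + w * C) * (Q * R) = B * (Q * S) * (1 - w) + C * (P * R) * (w - w * v)"
      if "R = S - S * w" "Q = P - P * v" for B C w v P Q R S :: "rat fps"
      unfolding that by (simp add: algebra_simps)
    note this[OF *]
    then have "qbinom fps_X (Suc n) (Suc k) * (qpoch 1 (Suc k) * qpoch 1 (Suc n - Suc k))
        = qbinom fps_X n (Suc k) * (qpoch 1 (Suc k) * qpoch 1 d) * (1 - fps_X ^ (n - k))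
        + qbinom fps_X n k * (qpoch 1 k * qpoch 1 (n - k)) * (fps_X ^ (n - k) - fps_X ^ (n - k) * fps_X ^ Suc k)"
      by (simp only: qbinom.simps diff_Suc_Suc)
    also have "\<dots> = qpoch 1 (Suc n)"
      unfolding 1 2 p by (simp add: algebra_simps)
    finally show ?thesis .
  qed
qed auto

lemma Suc_choose_2: "Suc n choose 2 = (n choose 2) + n"
  by (simp add: numeral_2_eq_2)

text \<open>Induction on the number of factors by the q-Pascal rule. An arbitrary commutative ring
  is allowed so that x and y can later be polynomials over power series.\<close>

lemma q_binomial_theorem:
  fixes q x y :: "'a::comm_ring_1"
  shows "(\<Prod>k<n. x + y * q ^ k) = (\<Sum>i\<le>n. qbinom q n i * q ^ (i choose 2) * x ^ (n - i) * y ^ i)"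
proof (induction n)
  case (Suc n)
  let ?t = "\<lambda>n i. qbinom q n i * q ^ (i choose 2) * x ^ (n - i) * y ^ i"
  have step: "?t (Suc n) (Suc i) = x * ?t n (Suc i) + y * q ^ n * ?t n i" if i: "i \<le> n" for i
  proof (cases "i = n")
    case True
    then show ?thesis
      unfolding Suc_choose_2 by (simp add: qbinom_eq_0 power_add algebra_simps)
  next
    case False
    then obtain d where n: "n = Suc (i + d)"
      using i less_imp_Suc_add[of i n] by auto
    show ?thesis
      unfolding Suc_choose_2 by (simp add: n power_add algebra_simps)
  qed
  have "(\<Sum>i\<le>Suc n. ?t (Suc n) i) = ?t (Suc n) 0 + (\<Sum>i\<le>n. ?t (Suc n) (Suc i))"
    by (rule sum.atMost_Suc_shift)
  also have "(\<Sum>i\<le>n. ?t (Suc n) (Suc i)) = (\<Sum>i\<le>n. x * ?t n (Suc i) + y * q ^ n * ?t n i)"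
    by (rule sum.cong) (use step in auto)
  also have "\<dots> = x * (\<Sum>i\<le>n. ?t n (Suc i)) + y * q ^ n * (\<Sum>i\<le>n. ?t n i)"
    by (simp only: sum.distrib sum_distrib_left)
  also have "?t (Suc n) 0 + (x * (\<Sum>i\<le>n. ?t n (Suc i)) + y * q ^ n * (\<Sum>i\<le>n. ?t n i)) =
     x * (\<Sum>i\<le>Suc n. ?t n i) + y * q ^ n * (\<Sum>i\<le>n. ?t n i)"
    unfolding sum.atMost_Suc_shift[of "?t n" n]
    by (simp add: algebra_simps del: sum.atMost_Suc)
  also have "(\<Sum>i\<le>Suc n. ?t n i) = (\<Sum>i\<le>n. ?t n i)"
    by (simp add: qbinom_eq_0)
  finally have "(\<Sum>i\<le>Suc n. ?t (Suc n) i) = x * (\<Sum>i\<le>n. ?t n i) + y * q ^ n * (\<Sum>i\<le>n. ?t n i)" .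
  then show ?case
    unfolding prod.lessThan_Suc Suc.IH by (simp add: algebra_simps del: sum.atMost_Suc)
qed (simp add: numeral_2_eq_2)

subsection \<open>Jacobi's identity\<close>

lemma qpoch_nth_0 [simp]: "j > 0 \<Longrightarrow> fps_nth (qpoch j n) 0 = 1"
  by (induction n) simp_all

lemma qpoch_nonzero [simp]: "j > 0 \<Longrightarrow> qpoch j n \<noteq> 0"
  using qpoch_nth_0[of j n] by (metis fps_zero_nth zero_neq_one)

lemma qbinom_symmetric:
  assumes "k \<le> n"
  shows   "qbinom (fps_X :: rat fps) n (n - k) = qbinom fps_X n k"
proof -
  have "qbinom fps_X n (n - k) * (qpoch 1 k * qpoch 1 (n - k)) = qbinom fps_X n k * (qpoch 1 k * qpoch 1 (n - k))"
    using qbinom_qpoch[of k n] qbinom_qpoch[of "n - k" n] assms by (simp add: mult.commute)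
  then show ?thesis by simp
qed

text \<open>Serves to apply the q-binomial theorem to polynomials in an auxiliary variable z, where
  q is a constant.\<close>

lemma qbinom_const_poly: "qbinom [:q:] n k = [:qbinom q n k:]"
  by (induction q n k rule: qbinom.induct) (auto simp: poly_const_pow one_pCons)

lemma add_choose_2: "(a + b) choose 2 = (a choose 2) + (b choose 2) + a * b"
  by (induction b) (auto simp: Suc_choose_2)

text \<open>In the expansion of the product of q^m - z q^k over k < 2m+1, the coefficient of z^i
  carries q to the power (i choose 2) + m (2m+1-i). The indices m-n and m+n+1 give the same power
  and can be paired.\<close>

lemma finite_jacobi_exponents:
  fixes m n :: nat
  assumes "n \<le> m"
  defines "t \<equiv> (m choose 2) + m * (m + 1) + (Suc n choose 2)"
  shows   "(m + Suc n choose 2) + m * (2 * m + 1 - (m + Suc n)) = t"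
    and   "(m - n choose 2) + m * (2 * m + 1 - (m - n)) = t"
proof -
  obtain d where m: "m = n + d"
    using assms(1) le_Suc_ex by blast
  show "(m + Suc n choose 2) + m * (2 * m + 1 - (m + Suc n)) = t"
    unfolding t_def add_choose_2[of m] by (simp add: m algebra_simps)
  have sq: "n * n = (n choose 2) + (n choose 2) + n"
    by (induction n) (simp_all add: Suc_choose_2)
  show "(m - n choose 2) + m * (2 * m + 1 - (m - n)) = t"
    unfolding t_def Suc_choose_2 m add_choose_2[of n d] using sq by (simp add: algebra_simps)
qed

text \<open>For k < m, q^m - q^k = -q^k (1 - q^(m-k)); reversing the order of the last factors gives
  \<open>qpoch 1 m\<close>.\<close>

lemma prod_below_eq_qpoch:
  "(\<Prod>k<m. fps_X ^ m - fps_X ^ k) = (-1) ^ m * fps_X ^ (m choose 2) * qpoch 1 m"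
proof -
  have tri: "(\<Prod>k<m. fps_X ^ k :: rat fps) = fps_X ^ (m choose 2)" for m
  proof (induction m)
    case (Suc m)
    then show ?case
      unfolding Suc_choose_2 by (simp only: prod.lessThan_Suc power_add)
  qed (simp add: numeral_2_eq_2)
  have "qpoch 1 m = (\<Prod>k<m. 1 - fps_X ^ Suc k)"
    unfolding qpoch_def One_nat_def prod.atLeast1_atMost_eq by simp
  also have "\<dots> = (\<Prod>k<m. 1 - fps_X ^ Suc (m - Suc k))"
    by (rule prod.nat_diff_reindex[symmetric])
  finally have "(-1) ^ m * fps_X ^ (m choose 2) * qpoch 1 m =
      (\<Prod>k<m. - 1 :: rat fps) * (\<Prod>k<m. fps_X ^ k) * (\<Prod>k<m. 1 - fps_X ^ Suc (m - Suc k))"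
    by (simp add: tri)
  also have "\<dots> = (\<Prod>k<m. (-1) * fps_X ^ k * (1 - fps_X ^ Suc (m - Suc k)))"
    by (simp only: prod.distrib)
  also have "\<dots> = (\<Prod>k<m. fps_X ^ m - fps_X ^ k)"
    by (rule prod.cong) (auto simp: algebra_simps Suc_diff_Suc simp flip: power_add power_Suc)
  finally show ?thesis ..
qed

lemma prod_above_eq_qpoch:
  "(\<Prod>k=Suc m..2*m. fps_X ^ m - fps_X ^ k) = fps_X ^ (m * m) * qpoch 1 m"
proof -
  have "(\<Prod>k=Suc m..2*m. fps_X ^ m - fps_X ^ k) = (\<Prod>k=1..m. fps_X ^ m - fps_X ^ (k + m) :: rat fps)"
    using prod.shift_bounds_cl_nat_ivl[of "\<lambda>k. fps_X ^ m - fps_X ^ k :: rat fps" 1 m m]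
    by (simp add: mult_2)
  also have "\<dots> = (\<Prod>k=1..m. fps_X ^ m * (1 - fps_X ^ k))"
    by (simp add: algebra_simps power_add)
  also have "\<dots> = fps_X ^ (m * m) * qpoch 1 m"
    unfolding qpoch_def prod.distrib by (simp add: power_mult)
  finally show ?thesis .
qed

lemma sum_atMost_fold_middle:
  fixes f :: "nat \<Rightarrow> 'a::comm_monoid_add"
  shows "(\<Sum>i\<le>2 * m + 1. f i) = (\<Sum>n\<le>m. f (m - n) + f (m + Suc n))"
proof -
  have "{..2 * m + 1} = {..m} \<union> {Suc m..2 * m + 1}"
    by auto
  then have "(\<Sum>i\<le>2 * m + 1. f i) = (\<Sum>i\<le>m. f i) + (\<Sum>i=Suc m..2 * m + 1. f i)"
    by (simp add: sum.union_disjoint)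
  also have "(\<Sum>i\<le>m. f i) = (\<Sum>n\<le>m. f (m - n))"
    by (rule sum.reindex_bij_witness[of _ "\<lambda>i. m - i" "\<lambda>i. m - i"]) auto
  also have "(\<Sum>i=Suc m..2 * m + 1. f i) = (\<Sum>n\<le>m. f (m + Suc n))"
    by (rule sum.reindex_bij_witness[of _ "\<lambda>n. m + Suc n" "\<lambda>i. i - Suc m"]) auto
  finally show ?thesis
    by (simp only: sum.distrib)
qed

text \<open>Expand the product of q^m - z q^k over k < 2m+1 by the q-binomial theorem, differentiate
  in z and put z = 1. The factor k = m vanishes there, which leaves a multiple of (q;q)_m^2; on the
  other side the paired terms produce the weights 2n+1.\<close>

lemma finite_jacobi_identity:
  "qpoch 1 m ^ 2 = (\<Sum>n\<le>m. (-1) ^ n * of_nat (2 * n + 1) * qbinom fps_X (2 * m + 1) (m - n) * fps_X ^ (Suc n choose 2))"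
proof -
  define N where "N = 2 * m + 1"
  \<comment> \<open>\<open>f k\<close> is q^m - z q^k as a polynomial in z.\<close>
  define f where "f k = [:fps_X ^ m:] + [:0, -1:] * [:(fps_X :: rat fps):] ^ k" for k
  define c :: "nat \<Rightarrow> rat fps"
    where "c i = qbinom fps_X N i * fps_X ^ (i choose 2) * (fps_X ^ m) ^ (N - i)" for i
  define t where "t = (m choose 2) + m * (m + 1)"
  have f: "poly (f k) 1 = fps_X ^ m - fps_X ^ k" "poly (pderiv (f k)) 1 = - (fps_X ^ k)" for k
    by (simp_all add: f_def poly_const_pow pderiv_pCons)
  have "(\<Prod>k<N. f k) = (\<Sum>i\<le>N. [:c i:] * [:0, -1:] ^ i)"
    unfolding f_def q_binomial_theorem c_def
    by (rule sum.cong) (simp_all add: qbinom_const_poly poly_const_pow mult_ac)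
  then have "poly (pderiv (\<Prod>k<N. f k)) 1 = (\<Sum>i\<le>N. poly (pderiv ([:c i:] * [:0, -1:] ^ i)) 1)"
    by (simp only: higher_pderiv_sum[of 1, simplified] poly_sum)
  also have "\<dots> = (\<Sum>i\<le>N. c i * (of_nat i * (-1) ^ i))"
  proof (rule sum.cong)
    fix i
    show "poly (pderiv ([:c i:] * [:0, -1:] ^ i)) 1 = c i * (of_nat i * (-1) ^ i)"
    proof (cases i)
      case (Suc n)
      show ?thesis
        unfolding Suc pderiv_mult pderiv_power_Suc
        by (simp add: pderiv_pCons algebra_simps del: of_nat_Suc)
    qed simp
  qed simp
  also have "\<dots> = (\<Sum>n\<le>m. c (m - n) * (of_nat (m - n) * (-1) ^ (m - n)) + c (m + Suc n) * (of_nat (m + Suc n) * (-1) ^ (m + Suc n)))"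
    unfolding N_def by (rule sum_atMost_fold_middle)
  also have "\<dots> = (\<Sum>n\<le>m. - ((-1) ^ m * fps_X ^ t) * ((-1) ^ n * of_nat (2 * n + 1) * qbinom fps_X N (m - n) * fps_X ^ (Suc n choose 2)))"
  proof (rule sum.cong)
    fix n assume "n \<in> {..m}"
    then have n: "n \<le> m" by simp
    have q: "qbinom (fps_X :: rat fps) N (m + Suc n) = qbinom fps_X N (m - n)"
      using qbinom_symmetric[of "m - n" N] n by (simp add: N_def)
    have c: "c (m + Suc n) = qbinom fps_X N (m - n) * (fps_X ^ t * fps_X ^ (Suc n choose 2))"
      "c (m - n) = qbinom fps_X N (m - n) * (fps_X ^ t * fps_X ^ (Suc n choose 2))"
      unfolding c_def q mult.assoc power_mult[symmetric] power_add[symmetric] t_def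
      unfolding N_def finite_jacobi_exponents[OF n] by simp_all
    have s: "(-1) ^ (m - n) = ((-1) ^ m * (-1) ^ n :: rat fps)"
      using n by (simp flip: power_add add: minus_one_power_iff)
    \<comment> \<open>The paired terms have opposite signs, so their weights combine to (m-n) -
      (m+n+1) = -(2n+1).\<close>
    have "of_nat (m + Suc n) = (of_nat (m - n) + of_nat (2 * n + 1) :: rat fps)"
      using n by (simp flip: of_nat_add)
    then show "c (m - n) * (of_nat (m - n) * (-1) ^ (m - n)) + c (m + Suc n) * (of_nat (m + Suc n) * (-1) ^ (m + Suc n))
      = - ((-1) ^ m * fps_X ^ t) * ((-1) ^ n * of_nat (2 * n + 1) * qbinom fps_X N (m - n) * fps_X ^ (Suc n choose 2))"
      unfolding c s power_add power_Suc
      by (simp only:) (simp add: algebra_simps del: of_nat_Suc of_nat_add of_nat_mult)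
  qed simp
  also have "\<dots> = - ((-1) ^ m * fps_X ^ t) * (\<Sum>n\<le>m. (-1) ^ n * of_nat (2 * n + 1) * qbinom fps_X N (m - n) * fps_X ^ (Suc n choose 2))"
    by (rule sum_distrib_left[symmetric])
  finally have rhs: "poly (pderiv (\<Prod>k<N. f k)) 1 = \<dots>" .
  have set: "{..<N} - {m} = {..<m} \<union> {Suc m..2*m}"
    by (auto simp: N_def)
  \<comment> \<open>Since \<open>f m\<close> vanishes at z = 1, the product rule leaves only its
    derivative -q^m times the remaining factors.\<close>
  have "poly (pderiv (\<Prod>k<N. f k)) 1 = poly (pderiv (f m * (\<Prod>k\<in>{..<N} - {m}. f k))) 1"
    by (subst prod.remove[of _ m]) (auto simp: N_def)
  also have "\<dots> = - (fps_X ^ m) * (\<Prod>k\<in>{..<N} - {m}. fps_X ^ m - fps_X ^ k)"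
    by (simp add: pderiv_mult f poly_prod)
  also have "\<dots> = - (fps_X ^ m) * ((\<Prod>k<m. fps_X ^ m - fps_X ^ k) * (\<Prod>k=Suc m..2*m. fps_X ^ m - fps_X ^ k))"
    unfolding set by (subst prod.union_disjoint) auto
  also have "\<dots> = - ((-1) ^ m * fps_X ^ t) * qpoch 1 m ^ 2"
    unfolding prod_below_eq_qpoch prod_above_eq_qpoch
    by (simp add: t_def power_add power2_eq_square algebra_simps)
  finally show ?thesis
    unfolding rhs by (simp add: N_def)
qed

text \<open>Modulo q^(k+1) the products (q;q)_k, (q;q)_(n-k) and (q;q)_n all agree with E_1. Hence
  E_1^2 times the binomial is E_1, and the unit E_1 cancels.\<close>

lemma qbinom_euler_E_dvd:
  assumes "k \<le> n" "k \<le> n - k"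
  shows   "fps_X ^ Suc k dvd euler_E 1 * qbinom fps_X n k - 1"
proof -
  let ?E = "euler_E 1" and ?q = "qbinom fps_X n k :: rat fps"
  have E: "fps_X ^ Suc k dvd ?E - qpoch 1 i" if "i \<ge> k" for i
    by (rule dvd_trans[OF le_imp_power_dvd euler_E_diff_qpoch_dvd]) (use that in auto)
  have "fps_X ^ Suc k dvd ?q * (?E * ?E) - ?q * (qpoch 1 k * qpoch 1 (n - k))"
    by (intro dvd_diff_mult E) (use assms in auto)
  then have "fps_X ^ Suc k dvd ?q * (?E * ?E) - qpoch 1 n"
    by (simp only: qbinom_qpoch[OF assms(1)])
  moreover have "fps_X ^ Suc k dvd qpoch 1 n - ?E"
    by (rule dvd_diff_sym, rule E) (use assms in simp)
  ultimately have "fps_X ^ Suc k dvd ?q * (?E * ?E) - ?E"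
    by (rule dvd_diff_trans)
  also have "?q * (?E * ?E) - ?E = ?E * (?E * ?q - 1)"
    by (simp add: algebra_simps)
  finally have "fps_X ^ Suc k dvd ?E * (?E * ?q - 1)" .
  moreover have "?E dvd 1"
    by simp
  ultimately show ?thesis
    by (simp only: dvd_mult_unit_iff')
qed

text \<open>Multiply the finite identity by E_1 and replace each product of E_1 with a Gaussian
  binomial by 1.\<close>

lemma jacobi_identity:
  "fps_X ^ Suc m dvd euler_E 1 ^ 3 - (\<Sum>n\<le>m. (-1) ^ n * of_nat (2 * n + 1) * fps_X ^ (Suc n choose 2))"
proof -
  let ?E = "euler_E 1" and ?t = "\<lambda>n. (Suc n choose 2)"
  let ?q = "\<lambda>n. qbinom fps_X (2 * m + 1) (m - n) :: rat fps"
  have "fps_X ^ Suc m dvd ?E * ?E ^ 2 - ?E * qpoch 1 m ^ 2"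
    by (intro dvd_diff_mult dvd_diff_power euler_E_diff_qpoch_dvd) auto
  moreover have "fps_X ^ Suc m dvd (\<Sum>n\<le>m. (-1) ^ n * of_nat (2 * n + 1) * fps_X ^ ?t n * (?E * ?q n))
      - (\<Sum>n\<le>m. (-1) ^ n * of_nat (2 * n + 1) * fps_X ^ ?t n * 1)"
  proof (rule dvd_diff_sum)
    fix n assume "n \<in> {..m}"
    then have n: "n \<le> m" by simp
    \<comment> \<open>The n-th error is only divisible by q^(m-n+1), but the triangular power in
      front contributes at least q^n.\<close>
    have "fps_X ^ ?t n * fps_X ^ Suc (m - n) dvd fps_X ^ ?t n * (?E * ?q n - 1)"
      by (rule mult_dvd_mono[OF dvd_refl qbinom_euler_E_dvd]) auto
    moreover have "fps_X ^ Suc m dvd (fps_X ^ ?t n * fps_X ^ Suc (m - n) :: rat fps)"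
      unfolding power_add[symmetric] Suc_choose_2 using n by (intro le_imp_power_dvd) auto
    ultimately have "fps_X ^ Suc m dvd fps_X ^ ?t n * (?E * ?q n - 1)"
      by (rule dvd_trans[rotated])
    then have "fps_X ^ Suc m dvd ((-1) ^ n * of_nat (2 * n + 1)) * (fps_X ^ ?t n * (?E * ?q n - 1))"
      by (rule dvd_mult)
    then show "fps_X ^ Suc m dvd (-1) ^ n * of_nat (2 * n + 1) * fps_X ^ ?t n * (?E * ?q n)
        - (-1) ^ n * of_nat (2 * n + 1) * fps_X ^ ?t n * 1"
      by (simp only: right_diff_distrib mult.assoc)
  qed
  moreover have "?E * qpoch 1 m ^ 2 = (\<Sum>n\<le>m. (-1) ^ n * of_nat (2 * n + 1) * fps_X ^ ?t n * (?E * ?q n))"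
    unfolding finite_jacobi_identity sum_distrib_left by (rule sum.cong) (simp_all only: ac_simps)
  ultimately show ?thesis
    by (simp only: power3_eq_cube power2_eq_square mult.assoc mult_1_right) (rule dvd_diff_trans)
qed

subsection \<open>The 3-dissection and its norm\<close>

definition fps_part :: "nat \<Rightarrow> 'a::comm_ring_1 fps \<Rightarrow> 'a fps" where
  "fps_part r f = Abs_fps (\<lambda>n. if n mod 3 = r then fps_nth f n else 0)"

lemma fps_part_nth: "fps_nth (fps_part r f) n = (if n mod 3 = r then fps_nth f n else 0)"
  by (simp add: fps_part_def)

lemma fps_part_linear [simp]:
  "fps_part r 0 = 0"
  "fps_part r (f + g) = fps_part r f + fps_part r g"
  "fps_part r (f - g) = fps_part r f - fps_part r g"
  "fps_part r (- f) = - fps_part r f"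
  by (auto intro!: fps_ext simp: fps_part_nth)

lemma fps_part_same: "fps_part r (fps_part r f) = fps_part r f"
  and fps_part_other: "r \<noteq> s \<Longrightarrow> fps_part r (fps_part s f) = 0"
  by (auto intro!: fps_ext simp: fps_part_nth)

lemma fps_part_sum: "fps_part r (sum f A) = (\<Sum>x\<in>A. fps_part r (f x))"
  by (induction A rule: infinite_finite_induct) simp_all

lemma fps_part_decompose: "f = fps_part 0 f + fps_part 1 f + fps_part 2 f"
proof (rule fps_ext)
  fix n :: nat
  consider "n mod 3 = 0" | "n mod 3 = 1" | "n mod 3 = 2"
    by linarith
  then show "fps_nth f n = fps_nth (fps_part 0 f + fps_part 1 f + fps_part 2 f) n"
    by cases (simp_all add: fps_part_nth)
qed

lemma fps_part_mult_parts:
  "fps_part ((r + s) mod 3) (fps_part r f * fps_part s g) = fps_part r f * fps_part s g"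
proof (rule fps_ext)
  fix n
  have "fps_nth (fps_part r f * fps_part s g) n = 0" if "n mod 3 \<noteq> (r + s) mod 3"
    unfolding fps_mult_nth
  proof (rule sum.neutral, rule ballI)
    fix i assume "i \<in> {0..n}"
    then have "i + (n - i) = n" by simp
    then have "(i mod 3 + (n - i) mod 3) mod 3 = n mod 3"
      by (metis mod_add_eq)
    with that show "fps_nth (fps_part r f) i * fps_nth (fps_part s g) (n - i) = 0"
      by (auto simp: fps_part_nth)
  qed
  then show "fps_nth (fps_part ((r + s) mod 3) (fps_part r f * fps_part s g)) n = fps_nth (fps_part r f * fps_part s g) n"
    by (simp add: fps_part_nth)
qed

lemma fps_part_mult_homogeneous:
  assumes "fps_part r f = f" "fps_part s g = g"
  shows   "fps_part ((r + s) mod 3) (f * g) = f * g"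
  using fps_part_mult_parts[of r s f g] by (simp add: assms)

lemma fps_part_homogeneous_other: "fps_part s f = f \<Longrightarrow> r \<noteq> s \<Longrightarrow> fps_part r f = 0"
  by (metis fps_part_other)

lemma fps_part_mult:
  "fps_part 0 (f * g) = fps_part 0 f * fps_part 0 g + fps_part 1 f * fps_part 2 g + fps_part 2 f * fps_part 1 g" (is ?T0)
  "fps_part 1 (f * g) = fps_part 0 f * fps_part 1 g + fps_part 1 f * fps_part 0 g + fps_part 2 f * fps_part 2 g" (is ?T1)
  "fps_part 2 (f * g) = fps_part 0 f * fps_part 2 g + fps_part 2 f * fps_part 0 g + fps_part 1 f * fps_part 1 g" (is ?T2)
proof -
  let ?f = "\<lambda>r. fps_part r f" and ?g = "\<lambda>r. fps_part r g"
  have "f * g = (?f 0 + ?f 1 + ?f 2) * (?g 0 + ?g 1 + ?g 2)"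
    using fps_part_decompose[of f] fps_part_decompose[of g] by (simp only:)
  also have "\<dots> = ?f 0 * ?g 0 + ?f 1 * ?g 2 + ?f 2 * ?g 1 + (?f 0 * ?g 1 + ?f 1 * ?g 0 + ?f 2 * ?g 2)
      + (?f 0 * ?g 2 + ?f 2 * ?g 0 + ?f 1 * ?g 1)"
    by (simp add: algebra_simps)
  finally have eq: "f * g = \<dots>" .
  have h: "fps_part t (?f r * ?g s) = (if t = (r + s) mod 3 then ?f r * ?g s else 0)" for t r s
    using fps_part_mult_parts[of r s f g] fps_part_homogeneous_other by metis
  show ?T0 ?T1 ?T2
    unfolding eq by (simp_all only: fps_part_linear h) simp_all
qed

lemma fps_part_0_mult_left:
  assumes "fps_part 0 f = f"
  shows   "fps_part 0 (f * g) = f * fps_part 0 g"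
  using assms fps_part_homogeneous_other[OF assms, of 1] fps_part_homogeneous_other[OF assms, of 2]
  by (simp add: fps_part_mult)

text \<open>The norm of \<open>f\<close> is the product of the three series \<open>f(\<omega>\<^sup>k q)\<close> with \<open>\<omega>\<close> a primitive
  third root of unity, written without \<open>\<omega>\<close>.\<close>

definition fps_norm3 :: "'a::comm_ring_1 fps \<Rightarrow> 'a fps" where
  "fps_norm3 f = fps_part 0 f ^ 3 + fps_part 1 f ^ 3 + fps_part 2 f ^ 3 - 3 * fps_part 0 f * fps_part 1 f * fps_part 2 f"

text \<open>The form a^3 + b^3 + c^3 - 3abc is a circulant determinant, and the three parts multiply
  like circulant matrices.\<close>

lemma fps_norm3_mult: "fps_norm3 (f * g) = fps_norm3 f * fps_norm3 g"
  unfolding fps_norm3_def fps_part_mult by (simp add: power3_eq_cube algebra_simps)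

lemma fps_part_const: "fps_part r (fps_const c) = (if r = 0 then fps_const c else 0)"
  by (rule fps_ext) (auto simp: fps_part_nth)

lemma fps_part_1: "fps_part r 1 = (if r = 0 then 1 else 0)"
  using fps_part_const[of r 1] by (simp only: fps_const_1_eq_1)

lemma fps_part_fps_X_power: "fps_part r (fps_X ^ n) = (if r = n mod 3 then fps_X ^ n else 0)"
  by (rule fps_ext) (auto simp: fps_part_nth fps_X_power_nth)

lemma fps_norm3_power: "fps_norm3 (f ^ n) = fps_norm3 f ^ n"
  by (induction n) (simp_all add: fps_norm3_mult, simp add: fps_norm3_def fps_part_1)

text \<open>If 3 divides n, everything lies in class 0. Otherwise 1 and -X^n lie in different
  classes and the third part is 0, so the norm is the sum of their cubes.\<close>

lemma fps_norm3_1_minus_X_power: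
  "fps_norm3 (1 - fps_X ^ n) = (if 3 dvd n then (1 - fps_X ^ n) ^ 3 else 1 - fps_X ^ (3 * n))"
proof -
  consider "n mod 3 = 0" | "n mod 3 = 1" | "n mod 3 = 2"
    by linarith
  then show ?thesis
  proof cases
    case 1
    then show ?thesis
      by (simp add: fps_norm3_def fps_part_1 fps_part_fps_X_power mod_eq_0_iff_dvd)
  next
    case 2
    then have "\<not> 3 dvd n"
      by presburger
    with 2 show ?thesis
      by (simp add: fps_norm3_def fps_part_1 fps_part_fps_X_power power_mult mult.commute[of 3])
  next
    case 3
    then have "\<not> 3 dvd n"
      by presburger
    with 3 show ?thesis
      by (simp add: fps_norm3_def fps_part_1 fps_part_fps_X_power power_mult mult.commute[of 3])
  qed
qed

lemma fps_part_dvd_diff: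
  assumes "fps_X ^ k dvd f - (g :: rat fps)"
  shows   "fps_X ^ k dvd fps_part r f - fps_part r g"
  using assms by (simp add: fps_X_power_dvd_iff_nth fps_part_nth)

lemma fps_norm3_dvd_diff:
  assumes "fps_X ^ k dvd f - (g :: rat fps)"
  shows   "fps_X ^ k dvd fps_norm3 f - fps_norm3 g"
proof -
  let ?f = "\<lambda>r. fps_part r f" and ?g = "\<lambda>r. fps_part r g"
  have p: "fps_X ^ k dvd ?f r - ?g r" for r
    by (rule fps_part_dvd_diff[OF assms])
  have "fps_X ^ k dvd (?f 0 ^ 3 - ?g 0 ^ 3) + (?f 1 ^ 3 - ?g 1 ^ 3) + (?f 2 ^ 3 - ?g 2 ^ 3)"
    by (intro dvd_add dvd_diff_power p)
  moreover have "fps_X ^ k dvd 3 * ?f 0 * ?f 1 * ?f 2 - 3 * ?g 0 * ?g 1 * ?g 2"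
    by (intro dvd_diff_mult p) simp
  ultimately have "fps_X ^ k dvd (?f 0 ^ 3 - ?g 0 ^ 3) + (?f 1 ^ 3 - ?g 1 ^ 3) + (?f 2 ^ 3 - ?g 2 ^ 3)
      - (3 * ?f 0 * ?f 1 * ?f 2 - 3 * ?g 0 * ?g 1 * ?g 2)"
    by (rule dvd_diff)
  then show ?thesis
    by (simp only: fps_norm3_def) (simp only: algebra_simps)
qed

text \<open>The norm of 1 - q^i is 1 - q^(3i) for i prime to 3, and (1 - q^(3k))^3 for i = 3k. The
  factors 1 - q^(9k) of \<open>qpoch 9 n\<close> fill the gaps in
  \<open>qpoch 3 (3 * n)\<close>.\<close>

lemma fps_norm3_qpoch:
  "fps_norm3 (qpoch 1 (3 * n)) * qpoch 9 n = qpoch 3 (3 * n) * qpoch 3 n ^ 3"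
proof (induction n)
  case (Suc n)
  let ?a = "\<lambda>i. 1 - fps_X ^ i :: rat fps"
  have 3: "qpoch j (3 * Suc n) = qpoch j (3 * n) * ?a (j * (3 * n + 1)) * ?a (j * (3 * n + 2)) * ?a (j * (3 * n + 3))" for j
    by (simp add: qpoch_Suc numeral_3_eq_3)
  have "3 dvd 3 * n + 3" "\<not> 3 dvd 3 * n + 1" "\<not> 3 dvd 3 * n + 2"
    by presburger+
  then have N: "fps_norm3 (?a (3 * n + 1)) = ?a (3 * (3 * n + 1))" "fps_norm3 (?a (3 * n + 2)) = ?a (3 * (3 * n + 2))"
     "fps_norm3 (?a (3 * n + 3)) = ?a (3 * Suc n) ^ 3"
    by (simp_all only: fps_norm3_1_minus_X_power if_True if_False) (simp add: add.commute)
  have 9: "qpoch 9 (Suc n) = qpoch 9 n * ?a (3 * (3 * n + 3))"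
    by (simp add: qpoch_Suc algebra_simps)
  have s: "qpoch 3 (Suc n) = qpoch 3 n * ?a (3 * Suc n)"
    by (rule qpoch_Suc)
  have "fps_norm3 (qpoch 1 (3 * Suc n)) * qpoch 9 (Suc n) =
     (fps_norm3 (qpoch 1 (3 * n)) * qpoch 9 n) * ?a (3 * (3 * n + 1)) * ?a (3 * (3 * n + 2)) * ?a (3 * Suc n) ^ 3 * ?a (3 * (3 * n + 3))"
    unfolding 3 9 fps_norm3_mult mult_1 N by (simp only: mult_ac)
  also have "\<dots> = qpoch 3 (3 * Suc n) * qpoch 3 (Suc n) ^ 3"
    unfolding Suc.IH s 3 power_mult_distrib by (simp only: mult_ac)
  finally show ?case .
qed (simp add: fps_norm3_def fps_part_1)

lemma fps_norm3_euler_E: "fps_norm3 (euler_E 1) * euler_E 9 = euler_E 3 ^ 4"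
proof (rule eq_if_fps_X_power_dvd_diff)
  fix k
  have E: "fps_X ^ k dvd euler_E j - qpoch j n" if "j > 0" "n \<ge> k" for j n
    by (rule dvd_trans[OF le_imp_power_dvd euler_E_diff_qpoch_dvd]) (use that in auto)
  have "fps_X ^ k dvd fps_norm3 (euler_E 1) * euler_E 9 - fps_norm3 (qpoch 1 (3 * k)) * qpoch 9 k"
    by (intro dvd_diff_mult fps_norm3_dvd_diff E) auto
  moreover have "fps_X ^ k dvd euler_E 3 * euler_E 3 ^ 3 - qpoch 3 (3 * k) * qpoch 3 k ^ 3"
    by (intro dvd_diff_mult dvd_diff_power E) auto
  ultimately have "fps_X ^ k dvd fps_norm3 (euler_E 1) * euler_E 9 - euler_E 3 * euler_E 3 ^ 3"
    unfolding fps_norm3_qpoch by (blast intro: dvd_diff_trans dvd_diff_sym)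
  then show "fps_X ^ k dvd fps_norm3 (euler_E 1) * euler_E 9 - euler_E 3 ^ 4"
    by (simp add: power_numeral_reduce)
qed

section \<open>The substitution of q^d for q\<close>

lemma fps_compose_X_power_mult:
  fixes f g :: "rat fps"
  assumes "d > 0"
  shows "(f * g) oo fps_X ^ d = (f oo fps_X ^ d) * (g oo fps_X ^ d)"
  by (rule fps_compose_mult_distrib) (use assms in simp)

lemma fps_compose_X_power_power:
  fixes f :: "rat fps"
  assumes "d > 0"
  shows "(f ^ n) oo fps_X ^ d = (f oo fps_X ^ d) ^ n"
  by (rule fps_compose_power[symmetric]) (use assms in simp)

lemma fps_X_power_compose_X_power: "d > 0 \<Longrightarrow> (fps_X ^ n oo fps_X ^ d :: rat fps) = fps_X ^ (d * n)"
  by (simp add: fps_compose_X_power_power power_mult)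

lemma fps_X_power_dvd_compose:
  assumes "fps_X ^ k dvd f - (g :: rat fps)" "d > 0"
  shows   "fps_X ^ k dvd (f oo fps_X ^ d) - (g oo fps_X ^ d)"
proof -
  obtain h where h: "f - g = fps_X ^ k * h"
    using assms(1) by blast
  have "(f oo fps_X ^ d) - (g oo fps_X ^ d) = fps_X ^ (d * k) * (h oo fps_X ^ d)"
    unfolding fps_compose_sub_distrib[symmetric] h
    by (simp add: assms(2) fps_compose_X_power_mult fps_X_power_compose_X_power)
  moreover have "fps_X ^ k dvd (fps_X ^ (d * k) :: rat fps)"
    using assms(2) by (intro le_imp_power_dvd) simp
  ultimately show ?thesis
    by simp
qed

lemma qpoch_compose: "d > 0 \<Longrightarrow> qpoch j n oo fps_X ^ d = qpoch (d * j) n"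
proof (induction n)
  case (Suc n)
  then show ?case
    unfolding qpoch_Suc
    by (simp add: fps_compose_X_power_mult fps_compose_sub_distrib fps_X_power_compose_X_power mult.assoc del: mult_Suc_right)
qed simp

lemma euler_E_compose:
  assumes "d > 0" "j > 0"
  shows   "euler_E j oo fps_X ^ d = euler_E (d * j)"
proof (rule eq_if_fps_X_power_dvd_diff)
  fix k
  have E: "fps_X ^ k dvd euler_E j - qpoch j k" if "j > 0" for j
    by (rule dvd_trans[OF le_imp_power_dvd euler_E_diff_qpoch_dvd]) (use that in auto)
  have "fps_X ^ k dvd (euler_E j oo fps_X ^ d) - qpoch (d * j) k"
    unfolding qpoch_compose[OF assms(1), symmetric] by (intro fps_X_power_dvd_compose E assms)
  moreover have "fps_X ^ k dvd qpoch (d * j) k - euler_E (d * j)"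
    by (rule dvd_diff_sym, rule E) (use assms in simp)
  ultimately show "fps_X ^ k dvd (euler_E j oo fps_X ^ d) - euler_E (d * j)"
    by (rule dvd_diff_trans)
qed

lemma fps_part_0_compose: "fps_part 0 (f oo fps_X ^ 3) = f oo fps_X ^ 3"
  by (rule fps_ext) (auto simp: fps_part_nth fps_nth_compose_X_power)

section \<open>The 3-dissection of E_1^3\<close>

lemma three_mult_choose_2: "3 * n choose 2 = 9 * (n choose 2) + 3 * n"
proof (induction n)
  case (Suc n)
  have "3 * Suc n = Suc (Suc (Suc (3 * n)))" by simp
  then show ?case
    using Suc by (simp only: Suc_choose_2) simp
qed simp

lemma fps_part_fps_const_mult: "fps_part r (fps_const c * f) = fps_const c * fps_part r f"
  by (rule fps_ext) (simp add: fps_part_nth)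

lemma sum_atMost_by_3:
  fixes f :: "nat \<Rightarrow> 'a::comm_monoid_add"
  shows "(\<Sum>n\<le>3 * k + 2. f n) = (\<Sum>n\<le>k. f (3 * n) + f (3 * n + 1) + f (3 * n + 2))"
proof (induction k)
  case (Suc k)
  have "3 * Suc k + 2 = Suc (Suc (Suc (3 * k + 2)))" "3 * Suc k = Suc (3 * k + 2)"
    "3 * Suc k + 1 = Suc (Suc (3 * k + 2))"
    by simp_all
  then show ?case
    using Suc by (simp only: sum.atMost_Suc add.assoc)
qed (simp add: numeral_2_eq_2 add.assoc)

text \<open>Triangular numbers are never 2 modulo 3. Those that are 1 modulo 3 come from the indices
  3n+1, and there Jacobi's series reproduces itself in q^9 with the factor -3q.\<close>

lemma fps_part_euler_E_cubed:
  "fps_part 1 (euler_E 1 ^ 3) = - (3 * (fps_X * euler_E 9 ^ 3))" (is ?T1)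
  "fps_part 2 (euler_E 1 ^ 3) = 0" (is ?T2)
proof -
  define c :: "nat \<Rightarrow> rat" where "c n = (-1) ^ n * of_nat (2 * n + 1)" for n
  define s where "s m = (\<Sum>n\<le>m. fps_const (c n) * fps_X ^ (Suc n choose 2))" for m
  have jac: "fps_X ^ Suc m dvd euler_E 1 ^ 3 - s m" for m
  proof -
    have "s m = (\<Sum>n\<le>m. (-1) ^ n * of_nat (2 * n + 1) * fps_X ^ (Suc n choose 2))"
    proof -
      have "(- 1 :: rat fps) = fps_const (- 1)"
        by simp
      then have "fps_const (c n) = (-1) ^ n * of_nat (2 * n + 1)" for n
        unfolding c_def by (simp only: fps_of_nat[symmetric] fps_const_power fps_const_mult)
      then show ?thesis
        by (simp only: s_def)
    qed
    then show ?thesis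
      using jacobi_identity[of m] by simp
  qed
  \<comment> \<open>The triangular numbers of 3n, 3n+1 and 3n+2, written so that their residues 0,
    1, 0 modulo 3 are visible.\<close>
  have e: "Suc (3 * n) choose 2 = 3 * (3 * (n choose 2) + 2 * n)"
    "Suc (3 * n + 1) choose 2 = 3 * (3 * (Suc n choose 2)) + 1"
    "Suc (3 * n + 2) choose 2 = 3 * (3 * (n choose 2) + 4 * n + 1)" for n
    by (simp_all add: Suc_choose_2 three_mult_choose_2)
  have mod: "(3 * x) mod 3 = 0" "(3 * x + 1) mod 3 = 1" for x :: nat
    by presburger+
  have parts: "fps_part 1 (s (3 * k + 2)) = (\<Sum>n\<le>k. fps_const (c (3 * n + 1)) * fps_X ^ (9 * (Suc n choose 2) + 1))"
    "fps_part 2 (s (3 * k + 2)) = 0" for k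
    unfolding s_def sum_atMost_by_3 fps_part_sum fps_part_linear fps_part_fps_const_mult e fps_part_fps_X_power mod
    by simp_all
  \<comment> \<open>The weight is 2(3n+1) + 1 = 3(2n+1), and the sign flips because 3n+1 and n have
    opposite parity.\<close>
  have c3: "fps_const (c (3 * n + 1)) = - 3 * fps_const (c n)" for n
  proof -
    have "c (3 * n + 1) = - 3 * c n"
      by (cases "even n") (simp_all add: c_def algebra_simps)
    then have "fps_const (c (3 * n + 1)) = fps_const (- 3) * fps_const (c n)"
      by simp
    then show ?thesis
      by (simp add: numeral_fps_const)
  qed
  have part1: "fps_part 1 (s (3 * k + 2)) = - (3 * (fps_X * (s k oo fps_X ^ 9)))" for k
  proof -
    have "s k oo fps_X ^ 9 = (\<Sum>n\<le>k. fps_const (c n) * fps_X ^ (9 * (Suc n choose 2)))"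
      by (simp add: s_def fps_compose_sum_distrib fps_compose_X_power_mult fps_X_power_compose_X_power)
    then show ?thesis
      unfolding parts c3 by (simp add: sum_distrib_left sum_negf[symmetric] power_add mult_ac)
  qed
  have dvd: "fps_X ^ k dvd fps_part r (euler_E 1 ^ 3) - fps_part r (s (3 * k + 2))" for r k
    by (intro fps_part_dvd_diff dvd_trans[OF le_imp_power_dvd jac]) simp
  show ?T2
    by (rule eq_if_fps_X_power_dvd_diff) (use dvd[of _ 2] parts(2) in simp)
  show ?T1
  proof (rule eq_if_fps_X_power_dvd_diff)
    fix k
    have "fps_X ^ k dvd (euler_E 1 ^ 3 oo fps_X ^ 9) - (s k oo fps_X ^ 9)"
      by (intro fps_X_power_dvd_compose dvd_trans[OF le_imp_power_dvd jac]) simp_all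
    then have "fps_X ^ k dvd (- 3) * (fps_X * euler_E 9 ^ 3) - (- 3) * (fps_X * (s k oo fps_X ^ 9))"
      by (intro dvd_diff_mult) (simp_all add: fps_compose_X_power_power euler_E_compose)
    then have "fps_X ^ k dvd - (3 * (fps_X * euler_E 9 ^ 3)) - fps_part 1 (s (3 * k + 2))"
      unfolding part1 by simp
    then show "fps_X ^ k dvd fps_part 1 (euler_E 1 ^ 3) - - (3 * (fps_X * euler_E 9 ^ 3))"
      using dvd[of k 1] by (blast intro: dvd_diff_trans dvd_diff_sym)
  qed
qed

subsection \<open>Extracting the exponents divisible by 3\<close>

text \<open>The operator U.\<close>

definition fps_multisect3 :: "'a::zero fps \<Rightarrow> 'a fps" where
  "fps_multisect3 f = Abs_fps (\<lambda>n. fps_nth f (3 * n))"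

lemma fps_multisect3_nth: "fps_nth (fps_multisect3 f) n = fps_nth f (3 * n)"
  by (simp add: fps_multisect3_def)

lemma fps_multisect3_add: "fps_multisect3 (f + g) = fps_multisect3 f + fps_multisect3 (g :: 'a::monoid_add fps)"
  by (rule fps_ext) (simp add: fps_multisect3_nth)

lemma fps_multisect3_compose: "fps_multisect3 f oo fps_X ^ 3 = fps_part 0 f"
  by (rule fps_ext) (auto simp: fps_nth_compose_X_power fps_multisect3_nth fps_part_nth)

text \<open>Identities for U can thus be checked after substituting q^3 for q, where U becomes
  \<open>fps_part 0\<close>.\<close>

lemma fps_compose_X_power_3_inject:
  assumes "f oo fps_X ^ 3 = g oo (fps_X ^ 3 :: 'a::comm_ring_1 fps)"
  shows "f = g"
proof (rule fps_ext)
  fix n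
  show "fps_nth f n = fps_nth g n"
    using fps_nth_compose_X_power[of f 3 "3 * n"] fps_nth_compose_X_power[of g 3 "3 * n"] assms by simp
qed

lemma fps_multisect3_mult_compose: "fps_multisect3 ((h oo fps_X ^ 3) * f) = h * fps_multisect3 (f :: rat fps)"
  by (rule fps_compose_X_power_3_inject)
    (simp add: fps_multisect3_compose fps_compose_X_power_mult fps_part_0_mult_left fps_part_0_compose)

section \<open>The series y and T and their cubic equation\<close>

definition y_ser :: "rat fps" where
  "y_ser = fps_X * euler_E 9 ^ 3 * inverse (euler_E 1) ^ 3"

definition t_ser :: "rat fps" where
  "t_ser = fps_X * euler_E 3 ^ 12 * inverse (euler_E 1) ^ 12"

lemma euler_E_inverse [simp]: "j > 0 \<Longrightarrow> euler_E j * inverse (euler_E j) = 1"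
  by (rule inverse_mult_eq_1') simp

lemma t_ser_compose: "(t_ser oo fps_X ^ 3) * euler_E 3 ^ 12 = fps_X ^ 3 * euler_E 9 ^ 12"
proof -
  have *: "(inverse (euler_E 1) oo fps_X ^ 3) * euler_E 3 = 1"
    using fps_compose_X_power_mult[of 3 "inverse (euler_E 1)" "euler_E 1"]
    by (simp add: euler_E_compose mult.commute)
  have "(t_ser oo fps_X ^ 3) * euler_E 3 ^ 12 = fps_X ^ 3 * euler_E 9 ^ 12 * ((inverse (euler_E 1) oo fps_X ^ 3) * euler_E 3) ^ 12"
    by (simp add: t_ser_def fps_compose_X_power_mult fps_compose_X_power_power euler_E_compose power_mult_distrib mult_ac)
  then show ?thesis
    unfolding * by simp
qed

lemma fps_part_numeral_mult: "fps_part r (numeral k * f) = numeral k * fps_part r f"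
  by (simp add: numeral_fps_const fps_part_fps_const_mult)

text \<open>Rationalise y = g / (p - 3g): with D = p^3 - 27g^3, a series in q^3, one has y = h g /
  D. The parts of h g are then 9g^3, p^2 g and 3p g^2 in the classes 0, 1 and 2.\<close>

lemma fps_part_cubic:
  fixes p g T y :: "rat fps"
  assumes p: "fps_part 0 p = p" and g: "fps_part 1 g = g" and T: "fps_part 0 T = T"
    and T_eq: "T * (p ^ 3 - 27 * g ^ 3) = g ^ 3" and y: "(p - 3 * g) * y = g"
    and nz: "p ^ 3 - 27 * g ^ 3 \<noteq> 0"
  shows "y ^ 3 = T * (1 + 9 * y + 27 * y ^ 2)"
    and "fps_part 0 y = 9 * T"
    and "fps_part 0 (y ^ 2) = 6 * T + 243 * T ^ 2"
proof -
  let ?D = "p ^ 3 - 27 * g ^ 3"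
  define h where "h = p ^ 2 + 3 * p * g + 9 * g ^ 2"
  have D: "?D = (p - 3 * g) * h"
    unfolding h_def by (simp add: power2_eq_square power3_eq_cube algebra_simps)
  have parts: "fps_part 0 p = p" "fps_part 1 p = 0" "fps_part 2 p = 0"
    "fps_part 0 g = 0" "fps_part 1 g = g" "fps_part 2 g = 0"
    using p g by (simp_all add: fps_part_homogeneous_other[OF p] fps_part_homogeneous_other[OF g])
  note part_simps = parts fps_part_linear fps_part_numeral_mult fps_part_mult mult.assoc
    power2_eq_square power3_eq_cube mult_zero_left mult_zero_right add_0_left add_0_right
  have D0: "fps_part 0 ?D = ?D"
    by (simp only: part_simps)
  have D_nz: "?D \<noteq> 0" by (rule nz)
  have F_nz: "p - 3 * g \<noteq> 0"
    using nz unfolding D by auto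
  have Dy: "?D * y = h * g"
    unfolding D using y by (simp add: mult_ac)
  show "y ^ 3 = T * (1 + 9 * y + 27 * y ^ 2)"
  proof -
    define F where "F = p - 3 * g"
    have g': "g = F * y"
      using y by (simp add: F_def)
    have "p = F + 3 * g"
      by (simp add: F_def)
    then have p': "p = F * (1 + 3 * y)"
      by (simp only: g') (simp add: algebra_simps)
    \<comment> \<open>Substituting p = F(1 + 3y) and g = F y into \<open>T_eq\<close> makes it
      homogeneous of degree 3 in F.\<close>
    have "F ^ 3 * (T * ((1 + 3 * y) ^ 3 - 27 * y ^ 3)) = F ^ 3 * y ^ 3"
      using T_eq unfolding p' g' power_mult_distrib by (simp add: algebra_simps)
    then have "T * ((1 + 3 * y) ^ 3 - 27 * y ^ 3) = y ^ 3"
      using F_nz by (simp add: F_def)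
    then show ?thesis
      by (simp add: power2_eq_square power3_eq_cube algebra_simps)
  qed
  show "fps_part 0 y = 9 * T"
  proof -
    have "?D * fps_part 0 y = fps_part 0 (h * g)"
      using fps_part_0_mult_left[OF D0, of y] by (simp only: Dy)
    also have "\<dots> = 9 * g ^ 3"
      unfolding h_def by (simp only: part_simps)
    also have "\<dots> = ?D * (9 * T)"
      by (subst T_eq[symmetric]) (simp only: mult_ac)
    finally show ?thesis
      using D_nz by (simp only: mult_cancel_left) simp
  qed
  show "fps_part 0 (y ^ 2) = 6 * T + 243 * T ^ 2"
  proof -
    have DD0: "fps_part 0 (?D * ?D) = ?D * ?D"
      by (simp only: fps_part_0_mult_left[OF D0] D0)
    have "?D * ?D * fps_part 0 (y ^ 2) = fps_part 0 ((?D * y) * (?D * y))"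
      using fps_part_0_mult_left[OF DD0, of "y ^ 2"] by (simp only: power2_eq_square mult_ac)
    also have "\<dots> = fps_part 0 (h * g) * fps_part 0 (h * g) + 2 * (fps_part 1 (h * g) * fps_part 2 (h * g))"
      unfolding Dy fps_part_mult(1)[of "h * g" "h * g"] by simp
    also have "\<dots> = (9 * g ^ 3) * (9 * g ^ 3) + 2 * ((p ^ 2 * g) * (3 * p * g ^ 2))"
      unfolding h_def by (simp only: part_simps)
    \<comment> \<open>The mixed term 6 p^3 g^3 is rewritten by p^3 = D + 27g^3, and 81 + 6 * 27 =
      243.\<close>
    also have "\<dots> = 6 * ?D * g ^ 3 + 243 * (g ^ 3) ^ 2"
      by (simp add: power2_eq_square power3_eq_cube algebra_simps)
    also have "\<dots> = ?D * ?D * (6 * T + 243 * T ^ 2)"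
    proof -
      have "6 * D * (T * D) + 243 * (T * D) ^ 2 = D * D * (6 * T + 243 * T ^ 2)" for D
        by (simp add: power2_eq_square ring_distribs mult_ac)
      from this[of ?D] show ?thesis
        by (simp only: T_eq)
    qed
    finally show ?thesis
      using D_nz by (simp only: mult_cancel_left) simp
  qed
qed

text \<open>The case where p is the class 0 part of E_1^3 and g = q E_9^3. The norm identity gives D
  = E_3^12 / E_9^3, and then T(q^3) D = q^3 E_9^9 = g^3.\<close>

lemma y_ser_parts:
  defines "T \<equiv> t_ser oo fps_X ^ 3"
  shows "y_ser ^ 3 = T * (1 + 9 * y_ser + 27 * y_ser ^ 2)"
    and "fps_part 0 y_ser = 9 * T"
    and "fps_part 0 (y_ser ^ 2) = 6 * T + 243 * T ^ 2"
proof -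
  define F where "F = euler_E 1 ^ 3"
  define p where "p = fps_part 0 F"
  define g where "g = fps_X * euler_E 9 ^ 3"
  have F: "F = p - 3 * g"
    using fps_part_decompose[of F] unfolding F_def g_def p_def fps_part_euler_E_cubed by simp
  have "fps_part 0 (euler_E 3 ^ 3 oo fps_X ^ 3) = euler_E 3 ^ 3 oo fps_X ^ 3"
    by (rule fps_part_0_compose)
  then have E: "fps_part 0 (euler_E 9 ^ 3) = euler_E 9 ^ 3"
    by (simp add: fps_compose_X_power_power euler_E_compose)
  have "fps_part 1 (fps_X :: rat fps) = fps_X"
    using fps_part_fps_X_power[of 1 1] by simp
  from fps_part_mult_homogeneous[OF this E] have g: "fps_part 1 g = g"
    by (simp add: g_def)
  have "fps_norm3 F = fps_norm3 (euler_E 1) ^ 3"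
    by (simp add: F_def fps_norm3_power)
  \<comment> \<open>The parts of F are p, -3g and 0, so the norm reduces to a sum of two
    cubes.\<close>
  moreover have "fps_norm3 F = p ^ 3 - 27 * g ^ 3"
    unfolding fps_norm3_def p_def[symmetric] unfolding F_def fps_part_euler_E_cubed g_def
    by (simp add: power_mult_distrib)
  ultimately have "(p ^ 3 - 27 * g ^ 3) * euler_E 9 ^ 3 = (fps_norm3 (euler_E 1) * euler_E 9) ^ 3"
    by (simp add: power_mult_distrib)
  then have D: "(p ^ 3 - 27 * g ^ 3) * euler_E 9 ^ 3 = euler_E 3 ^ 12"
    by (simp only: fps_norm3_euler_E flip: power_mult) simp
  then have "T * (p ^ 3 - 27 * g ^ 3) * euler_E 9 ^ 3 = T * euler_E 3 ^ 12"
    by (simp only: mult.assoc)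
  also have "\<dots> = fps_X ^ 3 * euler_E 9 ^ (3 * 3 + 3)"
    unfolding T_def t_ser_compose by simp
  also have "\<dots> = g ^ 3 * euler_E 9 ^ 3"
    unfolding g_def power_add power_mult power_mult_distrib by (simp only: mult.assoc)
  finally have "T * (p ^ 3 - 27 * g ^ 3) = g ^ 3"
    by simp
  moreover have "(p - 3 * g) * y_ser = g"
  proof -
    have "F * y_ser = g * (euler_E 1 * inverse (euler_E 1)) ^ 3"
      unfolding F_def g_def y_ser_def power_mult_distrib by (simp only: mult_ac)
    then show ?thesis
      by (simp flip: F)
  qed
  moreover have "p ^ 3 - 27 * g ^ 3 \<noteq> 0"
    using D by auto
  moreover have "fps_part 0 p = p" "fps_part 0 T = T"
    by (simp_all only: p_def fps_part_same T_def fps_part_0_compose)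
  ultimately show "y_ser ^ 3 = T * (1 + 9 * y_ser + 27 * y_ser ^ 2)"
    "fps_part 0 y_ser = 9 * T" "fps_part 0 (y_ser ^ 2) = 6 * T + 243 * T ^ 2"
    using fps_part_cubic[of p g T y_ser] g by blast+
qed

text \<open>Starting values of the recurrence; the coefficients are m(1,1) = 9, m(2,1) = 6 and
  m(2,2) = 27 * 9 = 243.\<close>

lemma fps_multisect3_y_ser:
  "fps_multisect3 1 = (1 :: rat fps)"
  "fps_multisect3 y_ser = 9 * t_ser"
  "fps_multisect3 (y_ser ^ 2) = 6 * t_ser + 243 * t_ser ^ 2"
  by (rule fps_compose_X_power_3_inject;
      simp add: fps_multisect3_compose y_ser_parts fps_part_1 fps_compose_X_power_mult
        fps_compose_X_power_power fps_compose_add_distrib)+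

text \<open>Multiply the cubic equation by y^n and apply U, which turns the factor T(q^3) into
  T.\<close>

lemma fps_multisect3_y_ser_power_rec:
  "fps_multisect3 (y_ser ^ (n + 3)) =
     t_ser * (27 * fps_multisect3 (y_ser ^ (n + 2)) + 9 * fps_multisect3 (y_ser ^ (n + 1)) + fps_multisect3 (y_ser ^ n))"
proof -
  have num: "fps_multisect3 (numeral k * f) = numeral k * fps_multisect3 f" for k and f :: "rat fps"
    using fps_multisect3_mult_compose[of "numeral k" f] by simp
  have "y_ser ^ (n + 3) = (t_ser oo fps_X ^ 3) * (27 * y_ser ^ (n + 2) + 9 * y_ser ^ (n + 1) + y_ser ^ n)"
    unfolding power_add y_ser_parts(1) by (simp add: algebra_simps)
  then show ?thesis
    by (simp only: fps_multisect3_mult_compose fps_multisect3_add num)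
qed

section \<open>Powers of y and the matrix m\<close>

lemma m_mat_nonpos: "i \<le> 0 \<Longrightarrow> m_mat i j = 0"
  by (induction i j rule: m_mat.induct) auto

lemma m_mat_eq_0_if_less: "i < int j \<Longrightarrow> m_mat i j = 0"
  by (induction i j rule: m_mat.induct) auto

text \<open>Both sides satisfy the same three-term recurrence. The upper limit N is left free so
  that the sums for the three preceding exponents can share one range.\<close>

lemma fps_multisect3_y_ser_power:
  assumes "n \<ge> 1" "N \<ge> n"
  shows "fps_multisect3 (y_ser ^ n) = (\<Sum>j=1..N. of_int (m_mat (int n) j) * t_ser ^ j)"
  using assms
proof (induction n arbitrary: N rule: less_induct)
  case (less n)
  define S where "S i N = (\<Sum>j=1..N. of_int (m_mat i j) * t_ser ^ j)" for i N
  have rec: "S i (Suc N) = of_int (m_mat i 1) * t_ser + t_ser * (27 * S (i - 1) N + 9 * S (i - 2) N + S (i - 3) N)"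
    if "i > 0" for i N
  proof -
    have "S i (Suc N) = of_int (m_mat i 1) * t_ser ^ 1 + (\<Sum>j=1..N. of_int (m_mat i (Suc j)) * t_ser ^ Suc j)"
      unfolding S_def One_nat_def sum.atLeast_Suc_atMost_Suc_shift
      by (subst sum.atLeast_Suc_atMost) (simp_all add: sum.atLeast_Suc_atMost_Suc_shift o_def)
    also have "(\<Sum>j=1..N. of_int (m_mat i (Suc j)) * t_ser ^ Suc j) =
      (\<Sum>j=1..N. t_ser * (27 * (of_int (m_mat (i - 1) j) * t_ser ^ j) + 9 * (of_int (m_mat (i - 2) j) * t_ser ^ j)
         + of_int (m_mat (i - 3) j) * t_ser ^ j))"
    proof (rule sum.cong)
      fix j assume "j \<in> {1..N}"
      then obtain k where "j = Suc k" by (cases j) auto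
      with that show "of_int (m_mat i (Suc j)) * t_ser ^ Suc j =
         t_ser * (27 * (of_int (m_mat (i - 1) j) * t_ser ^ j) + 9 * (of_int (m_mat (i - 2) j) * t_ser ^ j)
         + of_int (m_mat (i - 3) j) * t_ser ^ j)"
        by (simp add: algebra_simps)
    qed simp
    finally show ?thesis
      by (simp add: S_def sum.distrib sum_distrib_left[symmetric])
  qed
  have small: "S i N = 0" if "i \<le> 0" for i N
    using that by (simp add: S_def m_mat_nonpos)
  have IH: "S (int i) N = fps_multisect3 (y_ser ^ i)" if "i < n" "1 \<le> i" "N \<ge> i" for i N
    using less.IH that by (simp add: S_def)
  obtain M where M: "N = Suc M"
    using less.prems by (cases N) auto
  have r: "S (int n) N = of_int (m_mat (int n) 1) * t_ser
      + t_ser * (27 * S (int n - 1) M + 9 * S (int n - 2) M + S (int n - 3) M)"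
    unfolding M by (rule rec) (use less.prems in simp)
  consider "n = 1" | "n = 2" | "n = 3" | k where "n = k + 3" "k \<ge> 1"
    using less.prems by atomize_elim arith
  then have "S (int n) N = fps_multisect3 (y_ser ^ n)"
  proof cases
    case 1
    then show ?thesis
      unfolding r by (simp add: small fps_multisect3_y_ser)
  next
    case 2
    then have "S (int n - 1) M = 9 * t_ser"
      using IH[of 1 M] less.prems M by (simp add: fps_multisect3_y_ser)
    with 2 show ?thesis
      unfolding r by (simp add: small fps_multisect3_y_ser) (simp add: power2_eq_square)
  next
    case 3
    then have "S (int n - 2) M = fps_multisect3 (y_ser ^ 1)" "S (int n - 1) M = fps_multisect3 (y_ser ^ 2)"
      using IH[of 1 M] IH[of 2 M] less.prems M by simp_all
    \<comment> \<open>Row 0 of \<open>m_mat\<close> is zero although U(1) = 1; the entry m(3,1) = 1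
      supplies the missing term T.\<close>
    moreover have "m_mat (int n) 1 = 1" "S (int n - 3) M = 0"
      using 3 by (simp_all add: small)
    moreover have "fps_multisect3 (y_ser ^ n) = t_ser * (27 * fps_multisect3 (y_ser ^ 2) + 9 * fps_multisect3 (y_ser ^ 1) + 1)"
      using fps_multisect3_y_ser_power_rec[of 0] 3 by (simp only: add_0_left power_0 fps_multisect3_y_ser(1))
    ultimately show ?thesis
      unfolding r by (simp only: of_int_1) (simp add: algebra_simps)
  next
    case 4
    have "int n - 1 = int (k + 2)" "int n - 2 = int (k + 1)" "int n - 3 = int k"
      using 4 by simp_all
    moreover have "m_mat (int n) 1 = 0"
      using 4 by simp
    moreover have "S (int (k + 2)) M = fps_multisect3 (y_ser ^ (k + 2))"
      "S (int (k + 1)) M = fps_multisect3 (y_ser ^ (k + 1))" "S (int k) M = fps_multisect3 (y_ser ^ k)"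
      using less.prems 4 M by (intro IH; simp)+
    moreover have "fps_multisect3 (y_ser ^ n) = t_ser * (27 * fps_multisect3 (y_ser ^ (k + 2)) + 9 * fps_multisect3 (y_ser ^ (k + 1)) + fps_multisect3 (y_ser ^ k))"
      unfolding 4 by (rule fps_multisect3_y_ser_power_rec)
    ultimately show ?thesis
      unfolding r by (simp only: of_int_0 mult_zero_left add_0_left)
  qed
  then show ?case
    by (simp add: S_def)
qed

subsection \<open>The recursion\<close>

text \<open>Trades the implicit index set of the definition for a fixed range, so that sums can be
  interchanged later.\<close>

lemma b_mat_Suc:
  assumes "j \<ge> 1" "\<And>l. l > R \<Longrightarrow> b_mat j l = 0"
  shows "b_mat (Suc j) k = (\<Sum>l=1..R. b_mat j l * m_mat (4 * int l + 1) (l + k))"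
proof -
  obtain i where j: "j = Suc i"
    using assms(1) by (cases j) auto
  have "l \<le> R" if "b_mat (Suc i) l \<noteq> 0" for l
    using that assms(2)[of l] j by (cases "l > R") auto
  then show ?thesis
    unfolding j b_mat.simps(3) by (intro sum.mono_neutral_left) auto
qed

text \<open>The l-th series of the expansion without its coefficient, meant for l >= 1; at 0 the
  subtractions truncate.\<close>

definition eta_term :: "nat \<Rightarrow> rat fps" where
  "eta_term l = fps_X ^ (l - 1) * euler_E 3 ^ (12 * l - 3) * inverse (euler_E 1) ^ (12 * l + 3)"

lemma eta_term_Suc:
  "eta_term (Suc n) = fps_X ^ n * euler_E 3 ^ (12 * n + 9) * inverse (euler_E 1) ^ (12 * n + 15)"
proof -
  have "12 * Suc n - 3 = 12 * n + 9" "12 * Suc n + 3 = 12 * n + 15" by simp_all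
  then show ?thesis
    by (simp only: eta_term_def diff_Suc_1)
qed

text \<open>Extracting the exponents 1 modulo 3 is what leads from 3^j to 3^(j+1).\<close>

definition fps_sect1 :: "'a::zero fps \<Rightarrow> 'a fps" where
  "fps_sect1 f = Abs_fps (\<lambda>n. fps_nth f (3 * n + 1))"

text \<open>Multiplication by q^2 moves the exponent 3n+1 to 3(n+1), which reduces this extraction
  to U.\<close>

lemma fps_X_mult_fps_sect1: "fps_X * fps_sect1 f = fps_multisect3 (fps_X ^ 2 * (f :: rat fps))"
proof (rule fps_ext)
  fix n
  show "fps_nth (fps_X * fps_sect1 f) n = fps_nth (fps_multisect3 (fps_X ^ 2 * f)) n"
  proof (cases n)
    case (Suc m)
    have "3 + 3 * m - 2 = Suc (3 * m)" by simp
    then show ?thesis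
      by (simp add: Suc fps_sect1_def fps_multisect3_nth fps_X_power_mult_nth)
  qed (simp add: fps_multisect3_nth fps_X_power_mult_nth)
qed

lemma power_inverse_cancel:
  fixes e i :: "'a::comm_semiring_1"
  assumes "e * i = 1"
  shows "e ^ n * i ^ (n + m) = i ^ m"
proof -
  have "e ^ n * i ^ n = 1"
    using assms by (simp flip: power_mult_distrib)
  moreover have "e ^ n * i ^ (n + m) = (e ^ n * i ^ n) * i ^ m"
    by (simp add: power_add mult_ac)
  ultimately show ?thesis
    by simp
qed

text \<open>A factor A(q^3) turns q^2 times the l-th series into y^(4l+1). Applying U gives the sum
  of m(4l+1, l+k) T^(l+k), and T^(l+k) is A q times the k-th series, so A q cancels.\<close>

lemma fps_sect1_eta_term:
  assumes "l \<ge> 1"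
  shows "fps_sect1 (eta_term l) = (\<Sum>k=1..3 * l + 1. of_int (m_mat (4 * int l + 1) (l + k)) * eta_term k)"
proof -
  obtain a where l: "l = Suc a"
    using assms by (cases l) auto
  let ?e1 = "euler_E 1" and ?e3 = "euler_E 3" and ?e9 = "euler_E 9"
  let ?i1 = "inverse (euler_E 1)" and ?i3 = "inverse (euler_E 3)"
  have e1: "?e1 * ?i1 = 1" and e3: "?e3 * ?i3 = 1" by simp_all
  have *: "(?i1 oo fps_X ^ 3) * ?e3 = 1"
    using fps_compose_X_power_mult[of 3 ?i1 ?e1] by (simp add: euler_E_compose mult.commute)
  have "?i1 oo fps_X ^ 3 = ((?i1 oo fps_X ^ 3) * ?e3) * ?i3"
    by (simp only: mult.assoc e3 mult_1_right)
  then have i1: "?i1 oo fps_X ^ 3 = ?i3"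
    by (simp only: * mult_1_left)
  \<comment> \<open>In terms of l this is q^l E_3^(12l+3) / E_1^(12l-3), the quotient of T^(l+k) by
    q times the k-th series; it does not depend on k.\<close>
  define A where "A = fps_X ^ l * ?e3 ^ (12 * a + 15) * ?i1 ^ (12 * a + 9)"
  have A: "A oo fps_X ^ 3 = fps_X ^ (3 * l) * ?e9 ^ (12 * a + 15) * ?i3 ^ (12 * a + 9)"
    by (simp add: A_def fps_compose_X_power_mult fps_compose_X_power_power euler_E_compose i1[simplified] power_mult)
  have A_nz: "A \<noteq> 0"
    using e1 by (auto simp: A_def)
  have "(A oo fps_X ^ 3) * (fps_X ^ 2 * eta_term l) =
     (fps_X ^ (3 * l) * fps_X ^ 2 * fps_X ^ a) * ?e9 ^ (12 * a + 15) * ?i1 ^ (12 * a + 15) * (?e3 ^ (12 * a + 9) * ?i3 ^ (12 * a + 9))"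
    unfolding A l eta_term_Suc by (simp add: mult_ac)
  also have "?e3 ^ (12 * a + 9) * ?i3 ^ (12 * a + 9) = 1"
    using e3 by (simp flip: power_mult_distrib)
  also have "(fps_X ^ (3 * l) * fps_X ^ 2 * fps_X ^ a) * ?e9 ^ (12 * a + 15) * ?i1 ^ (12 * a + 15) * 1 = y_ser ^ (4 * l + 1)"
  proof -
    have e: "3 * l + 2 + a = 4 * l + 1" "12 * a + 15 = 3 * (4 * l + 1)"
      by (simp_all add: l)
    show ?thesis
      unfolding y_ser_def power_mult_distrib e power_add[symmetric] power_mult[symmetric] by simp
  qed
  finally have "A * (fps_X * fps_sect1 (eta_term l)) = fps_multisect3 (y_ser ^ (4 * l + 1))"
    unfolding fps_X_mult_fps_sect1 fps_multisect3_mult_compose[symmetric] by simp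
  also have "\<dots> = (\<Sum>j=1..4 * l + 1. of_int (m_mat (int (4 * l + 1)) j) * t_ser ^ j)"
    by (rule fps_multisect3_y_ser_power) simp_all
  \<comment> \<open>For j <= l the entry m(4l+1, j) vanishes because 4l+1 > 3j.\<close>
  also have "\<dots> = (\<Sum>j=l + 1..l + (3 * l + 1). of_int (m_mat (int (4 * l + 1)) j) * t_ser ^ j)"
    by (rule sum.mono_neutral_right) (auto simp: m_mat_eq_0)
  also have "\<dots> = (\<Sum>k=1..3 * l + 1. of_int (m_mat (int (4 * l + 1)) (l + k)) * t_ser ^ (l + k))"
    using sum.shift_bounds_cl_nat_ivl[of "\<lambda>j. of_int (m_mat (int (4 * l + 1)) j) * t_ser ^ j" 1 l "3 * l + 1"]
    by (simp only: add.commute)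
  also have "\<dots> = (\<Sum>k=1..3 * l + 1. A * fps_X * (of_int (m_mat (4 * int l + 1) (l + k)) * eta_term k))"
  proof (rule sum.cong)
    fix k assume "k \<in> {1..3 * l + 1}"
    then obtain c where k: "k = Suc c"
      by (cases k) auto
    have "A * fps_X * eta_term k = (fps_X ^ l * fps_X * fps_X ^ c) * (?e3 ^ (12 * a + 15) * ?e3 ^ (12 * c + 9)) * (?i1 ^ (12 * a + 9) * ?i1 ^ (12 * c + 15))"
      unfolding A_def k eta_term_Suc by (simp add: mult_ac)
    also have "\<dots> = fps_X ^ (l + k) * ?e3 ^ (12 * (l + k)) * ?i1 ^ (12 * (l + k))"
    proof -
      have "12 * a + 15 + (12 * c + 9) = 12 * (l + k)" "12 * a + 9 + (12 * c + 15) = 12 * (l + k)"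
        by (simp_all add: l k)
      then show ?thesis
        by (simp only: power_add[symmetric]) (simp add: k power_add)
    qed
    also have "\<dots> = t_ser ^ (l + k)"
      unfolding t_ser_def power_mult_distrib power_mult[symmetric] ..
    finally have t: "A * fps_X * eta_term k = t_ser ^ (l + k)" .
    have "int (4 * l + 1) = 4 * int l + 1" by simp
    then show "of_int (m_mat (int (4 * l + 1)) (l + k)) * t_ser ^ (l + k) = A * fps_X * (of_int (m_mat (4 * int l + 1) (l + k)) * eta_term k)"
      unfolding t[symmetric] by (simp only: mult_ac)
  qed simp
  also have "\<dots> = A * (fps_X * (\<Sum>k=1..3 * l + 1. of_int (m_mat (4 * int l + 1) (l + k)) * eta_term k))"
    by (simp only: sum_distrib_left mult.assoc)
  finally show ?thesis
    using A_nz by simp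
qed

section \<open>The sections of the generating function and the induction on j\<close>

definition p33_sect :: "nat \<Rightarrow> rat fps" where
  "p33_sect j = Abs_fps (\<lambda>n. p33 (3 ^ j * n + (3 ^ j + 1) div 2))"

lemma p33_sect_Suc: "p33_sect (Suc j) = fps_sect1 (p33_sect j)"
proof (rule fps_ext)
  fix n
  have "odd ((3 :: nat) ^ j)" by simp
  \<comment> \<open>Since 3^j is odd, the halves are exact and (3^(j+1) + 1)/2 = 3^j + (3^j +
    1)/2.\<close>
  then obtain d where d: "(3 :: nat) ^ j = 2 * d + 1" by (rule oddE)
  have "(3 ^ Suc j + 1) div 2 = 3 ^ j + (3 ^ j + 1) div (2 :: nat)"
    unfolding power_Suc d by simp
  then have "3 ^ Suc j * n + (3 ^ Suc j + 1) div 2 = 3 ^ j * (3 * n + 1) + (3 ^ j + 1) div (2 :: nat)"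
    by simp
  then show "fps_nth (p33_sect (Suc j)) n = fps_nth (fps_sect1 (p33_sect j)) n"
    by (simp only: p33_sect_def fps_sect1_def fps_nth_Abs_fps)
qed

text \<open>The exponents 3n+2 become multiples of 3 after multiplication by q. The further factor
  E_3^3 E_9^3, a series in q^3, turns q / (E_1^3 E_3^3) into y, and U(y) = 9T.\<close>

lemma p33_sect_1: "p33_sect 1 = 9 * eta_term 1"
proof -
  let ?e1 = "euler_E 1" and ?e3 = "euler_E 3" and ?e9 = "euler_E 9"
  let ?i1 = "inverse (euler_E 1)" and ?i3 = "inverse (euler_E 3)"
  have e1: "?e1 * ?i1 = 1" and e3: "?e3 * ?i3 = 1" by simp_all
  have p: "p33 n = fps_nth (?i1 ^ 3 * ?i3 ^ 3) n" for n
    unfolding p33_def by (simp add: fps_divide_unit fps_inverse_mult fps_inverse_power)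
  have "fps_X * p33_sect 1 = fps_multisect3 (fps_X * (?i1 ^ 3 * ?i3 ^ 3))"
  proof (rule fps_ext)
    fix n
    show "fps_nth (fps_X * p33_sect 1) n = fps_nth (fps_multisect3 (fps_X * (?i1 ^ 3 * ?i3 ^ 3))) n"
    proof (cases n)
      case (Suc m)
      have "3 + 3 * m - 1 = Suc (Suc (3 * m))" by simp
      then show ?thesis
        by (simp add: Suc p33_sect_def fps_multisect3_nth p)
    qed (simp add: fps_multisect3_nth)
  qed
  then have "?e1 ^ 3 * ?e3 ^ 3 * (fps_X * p33_sect 1) = fps_multisect3 ((?e1 ^ 3 * ?e3 ^ 3 oo fps_X ^ 3) * (fps_X * (?i1 ^ 3 * ?i3 ^ 3)))"
    by (simp only: fps_multisect3_mult_compose)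
  also have "(?e1 ^ 3 * ?e3 ^ 3 oo fps_X ^ 3) * (fps_X * (?i1 ^ 3 * ?i3 ^ 3)) = y_ser * (?e3 ^ 3 * ?i3 ^ 3)"
    by (simp add: y_ser_def fps_compose_X_power_mult fps_compose_X_power_power euler_E_compose power_mult_distrib mult_ac)
  also have "?e3 ^ 3 * ?i3 ^ 3 = 1"
    using e3 by (simp flip: power_mult_distrib)
  finally have "?e1 ^ 3 * ?e3 ^ 3 * (fps_X * p33_sect 1) = 9 * t_ser"
    by (simp add: fps_multisect3_y_ser)
  also have "\<dots> = ?e1 ^ 3 * ?e3 ^ 3 * (fps_X * (9 * eta_term 1))"
  proof -
    have "?e1 ^ 3 * ?e3 ^ 3 * (fps_X * (9 * eta_term 1)) = 9 * (fps_X * (?e3 ^ 3 * ?e3 ^ 9) * (?e1 ^ 3 * ?i1 ^ (3 + 12)))"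
      by (simp add: eta_term_def mult_ac)
    also have "\<dots> = 9 * t_ser"
      unfolding power_inverse_cancel[OF e1] power_add[symmetric] by (simp add: t_ser_def)
    finally show ?thesis ..
  qed
  finally show ?thesis
    by simp
qed

text \<open>The bound R on the support of row j is carried through the induction to keep all sums
  finite. It grows to 3R+1, since m(4l+1, l+k) = 0 for k > 3l+1.\<close>

lemma p33_sect_expansion:
  assumes "j \<ge> 1"
  shows "\<exists>R. (\<forall>l>R. b_mat j l = 0) \<and> p33_sect j = (\<Sum>l=1..R. of_int (b_mat j l) * eta_term l)"
  using assms
proof (induction j rule: dec_induct)
  case base
  show ?case
    by (rule exI[of _ 1]) (simp add: p33_sect_1[simplified])
next
  case (step j)
  then obtain R where R: "\<And>l. l > R \<Longrightarrow> b_mat j l = 0"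
    "p33_sect j = (\<Sum>l=1..R. of_int (b_mat j l) * eta_term l)"
    by blast
  let ?R = "3 * R + 1"
  let ?m = "\<lambda>l k. m_mat (4 * int l + 1) (l + k)"
  have b: "b_mat (Suc j) k = (\<Sum>l=1..R. b_mat j l * ?m l k)" for k
    using step.hyps(1) R(1) by (rule b_mat_Suc)
  have "b_mat (Suc j) k = 0" if "k > ?R" for k
    unfolding b using that by (intro sum.neutral) (auto intro!: m_mat_eq_0_if_less)
  moreover have "p33_sect (Suc j) = (\<Sum>k=1..?R. of_int (b_mat (Suc j) k) * eta_term k)"
  proof -
    have "p33_sect (Suc j) = (\<Sum>l=1..R. of_int (b_mat j l) * fps_sect1 (eta_term l))"
      unfolding p33_sect_Suc R(2)
      by (rule fps_ext) (simp add: fps_sect1_def fps_sum_nth flip: fps_of_int)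
    also have "\<dots> = (\<Sum>l=1..R. \<Sum>k=1..?R. of_int (b_mat j l * ?m l k) * eta_term k)"
    proof (rule sum.cong)
      fix l assume l: "l \<in> {1..R}"
      \<comment> \<open>The inner sums are padded with zero terms to a range independent of l, so
        that the summations can be swapped.\<close>
      have "(\<Sum>k=1..3 * l + 1. of_int (?m l k) * eta_term k) = (\<Sum>k=1..?R. of_int (?m l k) * eta_term k)"
        using l by (intro sum.mono_neutral_left) (auto simp: m_mat_eq_0_if_less)
      then show "of_int (b_mat j l) * fps_sect1 (eta_term l) = (\<Sum>k=1..?R. of_int (b_mat j l * ?m l k) * eta_term k)"
        using fps_sect1_eta_term[of l] l by (simp only: sum_distrib_left of_int_mult mult.assoc atLeastAtMost_iff)
    qed simp
    also have "\<dots> = (\<Sum>k=1..?R. \<Sum>l=1..R. of_int (b_mat j l * ?m l k) * eta_term k)"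
      by (rule sum.swap)
    also have "\<dots> = (\<Sum>k=1..?R. of_int (b_mat (Suc j) k) * eta_term k)"
      unfolding b of_int_sum sum_distrib_right ..
    finally show ?thesis .
  qed
  ultimately show ?case
    by blast
qed

theorem theorem3p5:
  fixes j :: nat
  assumes "j \<ge> 1"
  shows "((\<lambda>l. fps_const (of_int (b_mat j l)) * fps_X ^ (l - 1)
             * (euler_E 3 ^ (12 * l - 3) / euler_E 1 ^ (12 * l + 3)))
          has_sum Abs_fps (\<lambda>n. p33 (3 ^ j * n + (3 ^ j + 1) div 2))) {1..}"
proof -
  obtain R where R: "\<And>l. l > R \<Longrightarrow> b_mat j l = 0"
    "p33_sect j = (\<Sum>l=1..R. of_int (b_mat j l) * eta_term l)"
    using p33_sect_expansion[OF assms] by blast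
  show ?thesis
    unfolding p33_sect_def[symmetric] R(2)
  \<comment> \<open>All terms with l > R vanish, so the infinite sum is a finite one.\<close>
  proof (rule has_sum_finite_neutralI[of "{1..R}"])
    show "(\<Sum>l=1..R. of_int (b_mat j l) * eta_term l) = (\<Sum>l=1..R. fps_const (of_int (b_mat j l)) * fps_X ^ (l - 1)
             * (euler_E 3 ^ (12 * l - 3) / euler_E 1 ^ (12 * l + 3)))"
      by (rule sum.cong) (simp_all add: eta_term_def fps_divide_unit fps_inverse_power fps_of_int mult.assoc)
  qed (use R(1) in auto)
qed

end
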